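(* Let $I=(\vec P,m)$ be an instance of SEBP in which every job is short, i.e. $\mathbb P[0\le P_j\le1]=1$ for all $j$, and let $\rho=\frac1m\sum_j\mathbb E[P_j]$. Then $$\frac{\mathrm{LEPT}_{\mathcal F}}{m\max(\rho,1)}\le1+e^{-1}.$$ In particular, over the set of instances with short jobs only, $\mathrm{LEPT}_{\mathcal F}\le(1+e^{-1})\,OPT_{\mathcal P}$, i.e. $\mathrm{LEPT}_{\mathcal F}$ is a $(1+e^{-1})$-approximation in the class $\mathcal P$.
   Context: Stochastic extensible bin packing (SEBP): an instance $I=(\vec P,m)$ consists of $m$ identical machines, each with unit regular capacity, and $n>m$ jobs whose processing times $P_1,\dots,P_n$ are mutually independent nonnegative random variables with finite expectations. A scheduling policy maps each realization to a feasible schedule (start times and machine assignments, no machine processing two jobs at once) in a non-anticipatory way (decisions at time $t$ depend only on durations of jobs completed before $t$ and on conditional distributions of the rest). For a policy $\Pi$ the workload $X_i^\Pi$ of machine $i$ is the latest completion time of a job on $i$, and its cost is $\Phi(\Pi)=\mathbb E[\sum_i\max(X_i^\Pi,1)]$; $OPT_{\mathcal P}$ is the infimum of $\Phi$ over all scheduling policies. $\mathrm{LEPT}_{\mathcal F}$ is the fixed-assignment policy obtained as follows: jobs are considered in nonincreasing order of $\mathbb E[P_j]$ and each is assigned to a machine whose current total expected load (sum of $\mathbb E[P_{j'}]$ over jobs already assigned to it) is smallest; this assignment is fixed before any processing time is revealed and each machine processes its jobs without idle time. We also write $\mathrm{LEPT}_{\mathcal F}$ for its cost $\Phi(\mathrm{LEPT}_{\mathcal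 F})=\sum_i\mathbb E[\max(\sum_{j\to i}P_j,1)]$. *)

theory Defs
  imports "HOL-Probability.Probability"
begin

text \<open>
  Jobs are \<open>{..<n}\<close> and machines \<open>{..<m}\<close>. A realization of the processing times is an
  (extensional) function \<open>p\<close> on \<open>{..<n}\<close>.
\<close>

definition sebp_instance :: "'a measure \<Rightarrow> (nat \<Rightarrow> 'a \<Rightarrow> real) \<Rightarrow> nat \<Rightarrow> nat \<Rightarrow> bool" where
  "sebp_instance M P n m \<longleftrightarrow>
     prob_space M \<and> 1 \<le> m \<and> m < n \<and>
     prob_space.indep_vars M (\<lambda>_. borel) P {..<n} \<and>
     (\<forall>j<n. integrable M (P j) \<and> (AE \<omega> in M. 0 \<le> P j \<omega>))"

definition realizations :: "nat \<Rightarrow> (nat \<Rightarrow> real) set" where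
  "realizations n = {..<n} \<rightarrow>\<^sub>E {0..}"

record schedule =
  start :: "nat \<Rightarrow> real"
  machine :: "nat \<Rightarrow> nat"

type_synonym policy = "(nat \<Rightarrow> real) \<Rightarrow> schedule"

definition feasible :: "nat \<Rightarrow> nat \<Rightarrow> (nat \<Rightarrow> real) \<Rightarrow> schedule \<Rightarrow> bool" where
  "feasible n m p s \<longleftrightarrow>
     (\<forall>j<n. 0 \<le> start s j \<and> machine s j < m) \<and>
     (\<forall>j<n. \<forall>k<n. j \<noteq> k \<and> machine s j = machine s k \<longrightarrow>
        start s j + p j \<le> start s k \<or> start s k + p k \<le> start s j)"

text \<open>
  Non-anticipativity: the starts of a schedule are decisions taken one after the other, in an
  order \<open>q p 0, q p 1, \<dots>\<close> of nondecreasing start times. Two realizations are indistinguishable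
  for the next decision, taken at time \<open>t\<close>, if all previous decisions coincide, the jobs completed
  by time \<open>t\<close> have the same durations, and the jobs still running at time \<open>t\<close> are the same; the
  next decision must then be the same. Time alone does not order the decisions, because a job
  of duration \<open>0\<close> is started and completed at the same instant: its duration may influence
  later decisions at this instant, but not the decision to start it.
\<close>

definition same_observation ::
    "real \<Rightarrow> schedule \<Rightarrow> (nat \<Rightarrow> real) \<Rightarrow> schedule \<Rightarrow> (nat \<Rightarrow> real) \<Rightarrow> nat \<Rightarrow> bool" where
  "same_observation t s p s' p' j \<longleftrightarrow>
     start s' j = start s j \<and> machine s' j = machine s j \<and>
     (if start s j + p j \<le> t then p' j = p j else t < start s j + p' j)"

definition non_anticipatory :: "nat \<Rightarrow> policy \<Rightarrow> bool" where
  "non_anticipatory n \<pi> \<longleftrightarrow>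
     (\<exists>q :: (nat \<Rightarrow> real) \<Rightarrow> nat \<Rightarrow> nat.
       (\<forall>p\<in>realizations n. bij_betw (q p) {..<n} {..<n} \<and>
          (\<forall>k<n. \<forall>l<k. start (\<pi> p) (q p l) \<le> start (\<pi> p) (q p k))) \<and>
       (\<forall>p\<in>realizations n. \<forall>p'\<in>realizations n. \<forall>k<n.
          (\<forall>l<k. q p' l = q p l \<and>
             same_observation (start (\<pi> p) (q p k)) (\<pi> p) p (\<pi> p') p' (q p l)) \<longrightarrow>
          q p' k = q p k \<and>
          start (\<pi> p') (q p k) = start (\<pi> p) (q p k) \<and>
          machine (\<pi> p') (q p k) = machine (\<pi> p) (q p k)))"

definition policies :: "nat \<Rightarrow> nat \<Rightarrow> policy set" where
  "policies n m = {\<pi>.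
     (\<forall>p\<in>realizations n. feasible n m p (\<pi> p)) \<and>
     non_anticipatory n \<pi> \<and>
     (\<forall>j<n. (\<lambda>p. start (\<pi> p) j) \<in> borel_measurable (Pi\<^sub>M {..<n} (\<lambda>_. borel)) \<and>
            (\<lambda>p. machine (\<pi> p) j) \<in> measurable (Pi\<^sub>M {..<n} (\<lambda>_. borel)) (count_space UNIV))}"

text \<open>A machine without jobs has workload \<open>0\<close>.\<close>

definition workload :: "nat \<Rightarrow> (nat \<Rightarrow> real) \<Rightarrow> schedule \<Rightarrow> nat \<Rightarrow> real" where
  "workload n p s i = Max (insert 0 {start s j + p j | j. j < n \<and> machine s j = i})"

text \<open>Extended nonnegative reals, since a policy may idle and have infinite expected cost.\<close>

definition cost :: "'a measure \<Rightarrow> (nat \<Rightarrow> 'a \<Rightarrow> real) \<Rightarrow> nat \<Rightarrow> nat \<Rightarrow> policy \<Rightarrow> ennreal" where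
  "cost M P n m \<pi> =
     (\<integral>\<^sup>+\<omega>. (let p = (\<lambda>j\<in>{..<n}. P j \<omega>)
            in ennreal (\<Sum>i<m. max (workload n p (\<pi> p) i) 1)) \<partial>M)"

definition opt_cost :: "'a measure \<Rightarrow> (nat \<Rightarrow> 'a \<Rightarrow> real) \<Rightarrow> nat \<Rightarrow> nat \<Rightarrow> ennreal" where
  "opt_cost M P n m = (INF \<pi>\<in>policies n m. cost M P n m \<pi>)"

text \<open>
  \<open>r j\<close> is the position of job \<open>j\<close> in the list in which the jobs are considered and \<open>a j\<close> the
  machine it is assigned to. Ties, both in the order and between machines, are broken arbitrarily.
\<close>

definition lept_assignment ::
    "'a measure \<Rightarrow> (nat \<Rightarrow> 'a \<Rightarrow> real) \<Rightarrow> nat \<Rightarrow> nat \<Rightarrow> (nat \<Rightarrow> nat) \<Rightarrow> (nat \<Rightarrow> nat) \<Rightarrow> bool" where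
  "lept_assignment M P n m r a \<longleftrightarrow>
     bij_betw r {..<n} {..<n} \<and>
     (\<forall>j<n. \<forall>k<n. r j < r k \<longrightarrow> integral\<^sup>L M (P k) \<le> integral\<^sup>L M (P j)) \<and>
     (\<forall>j<n. a j < m \<and>
       (\<forall>i<m. (\<Sum>l | l < n \<and> r l < r j \<and> a l = a j. integral\<^sup>L M (P l))
             \<le> (\<Sum>l | l < n \<and> r l < r j \<and> a l = i. integral\<^sup>L M (P l))))"

definition fixed_assignment_policy :: "nat \<Rightarrow> (nat \<Rightarrow> nat) \<Rightarrow> (nat \<Rightarrow> nat) \<Rightarrow> policy" where
  "fixed_assignment_policy n r a p =
     \<lparr>start = (\<lambda>j. \<Sum>l | l < n \<and> r l < r j \<and> a l = a j. p l), machine = a\<rparr>"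


lemma fixed_assignment_policy_simps [simp]:
  "start (fixed_assignment_policy n r a p) j = (\<Sum>l | l < n \<and> r l < r j \<and> a l = a j. p l)"
  "machine (fixed_assignment_policy n r a p) = a"
  by (simp_all add: fixed_assignment_policy_def)

lemma fixed_completion:
  assumes "inj_on r {..<n}" "j < n"
  shows "start (fixed_assignment_policy n r a p) j + p j
         = (\<Sum>l | l < n \<and> r l \<le> r j \<and> a l = a j. p l)"
proof -
  have "{l. l < n \<and> r l \<le> r j \<and> a l = a j} = insert j {l. l < n \<and> r l < r j \<and> a l = a j}"
    using assms by (auto simp: inj_on_def le_less)
  then show ?thesis by simp
qed

lemma fixed_completion_le:
  assumes "inj_on r {..<n}" "p \<in> realizations n" "j < n" "k < n" "a j = a k" "r j < r k"
  shows "start (fixed_assignment_policy n r a p) j + p j \<le> start (fixed_assignment_policy n r a p) k"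
  unfolding fixed_completion[OF assms(1,3)] unfolding fixed_assignment_policy_simps
  using assms by (intro sum_mono2) (auto simp: realizations_def PiE_iff)

lemma enumerate_wrt:
  fixes f :: "nat \<Rightarrow> real"
  assumes r: "inj_on r {..<n}"
  shows "\<exists>q. bij_betw q {..<n} {..<n} \<and>
    (\<forall>k<n. \<forall>l<k. f (q l) < f (q k) \<or> f (q l) = f (q k) \<and> r (q l) < (r (q k) :: nat))"
proof -
  define xs where "xs = sort_key f (sort_key r [0..<n])"
  have d: "distinct xs" and s: "set xs = {..<n}" and len: "length xs = n"
    by (auto simp: xs_def)
  have "sorted_wrt (\<lambda>x y. f x < f y \<or> f x = f y \<and> r x \<le> r y) xs"
  proof -
    have "sorted (map r (sort_key r [0..<n]))" by simp
    moreover have "sorted_wrt (\<lambda>x y. f x < f y \<or> f x = f y \<and> r x \<le> r y) (sort_key f ys)"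
      if "sorted (map r ys)" for ys :: "nat list"
      using that
    proof (induction ys)
      case (Cons y ys)
      have ins: "sorted_wrt (\<lambda>x y. f x < f y \<or> f x = f y \<and> r x \<le> r y) (insort_key f y zs)"
        if "sorted_wrt (\<lambda>x y. f x < f y \<or> f x = f y \<and> r x \<le> r y) zs" "\<forall>z\<in>set zs. r y \<le> r z" for zs
        using that
      proof (induction zs)
        case (Cons z zs)
        show ?case
        proof (cases "f y \<le> f z")
          case True
          have "f y < f x \<or> f y = f x \<and> r y \<le> r x" if "x \<in> set (z # zs)" for x
          proof -
            have "f z \<le> f x" using Cons.prems(1) that by auto
            moreover have "r y \<le> r x" using Cons.prems(2) that by blast
            ultimately show ?thesis using True by linarith
          qed
          then show ?thesis using Cons.prems(1) True by simp
        next
          case False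
          then show ?thesis using Cons by (simp add: set_insort_key not_le)
        qed
      qed simp
      show ?case using Cons by (auto intro!: ins)
    qed simp
    ultimately show ?thesis unfolding xs_def by blast
  qed
  then have *: "f (xs ! l) < f (xs ! k) \<or> f (xs ! l) = f (xs ! k) \<and> r (xs ! l) \<le> r (xs ! k)"
    if "l < k" "k < n" for k l
    using that len by (auto simp: sorted_wrt_iff_nth_less)
  have b: "bij_betw ((!) xs) {..<n} {..<n}"
    by (rule bij_betw_nth[OF d]) (simp_all only: s len)
  have ne: "r (xs ! l) \<noteq> r (xs ! k)" if "l < k" "k < n" for k l
  proof -
    have "xs ! l \<noteq> xs ! k" using d that len by (simp add: nth_eq_iff_index_eq)
    moreover have "xs ! l < n" "xs ! k < n"
      using that nth_mem[of l xs] nth_mem[of k xs] unfolding s len by simp_all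
    ultimately show ?thesis using r by (auto simp: inj_on_def)
  qed
  have "f (xs ! l) < f (xs ! k) \<or> f (xs ! l) = f (xs ! k) \<and> r (xs ! l) < r (xs ! k)"
    if "l < k" "k < n" for k l
    using *[OF that] ne[OF that] by linarith
  with b show ?thesis by blast
qed

lemma fixed_assignment_policy_in_policies:
  assumes r: "inj_on r {..<n}" and a: "\<forall>j<n. a j < m"
  shows "fixed_assignment_policy n r a \<in> policies n m"
proof -
  let ?F = "fixed_assignment_policy n r a"
  have feas: "feasible n m p (?F p)" if p: "p \<in> realizations n" for p
    unfolding feasible_def
  proof (intro conjI allI impI)
    fix j k assume jk: "j < n" "k < n" "j \<noteq> k \<and> machine (?F p) j = machine (?F p) k"
    then have "r j < r k \<or> r k < r j" using r by (metis inj_on_eq_iff lessThan_iff nat_neq_iff)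
    then show "start (?F p) j + p j \<le> start (?F p) k \<or> start (?F p) k + p k \<le> start (?F p) j"
      using fixed_completion_le[OF r p, of j k a] fixed_completion_le[OF r p, of k j a] jk
      by (auto simp del: fixed_assignment_policy_simps(1))
  qed (use a p in \<open>auto simp: realizations_def PiE_iff intro!: sum_nonneg\<close>)
  have meas: "(\<lambda>p. start (?F p) j) \<in> borel_measurable (Pi\<^sub>M {..<n} (\<lambda>_. borel))" for j
    unfolding fixed_assignment_policy_simps by (intro borel_measurable_sum) auto
  define before where "before p i j \<longleftrightarrow> start (?F p) i < start (?F p) j \<or>
      start (?F p) i = start (?F p) j \<and> r i < r j" for p i j
  have "\<forall>p. \<exists>q. bij_betw q {..<n} {..<n} \<and> (\<forall>k<n. \<forall>l<k. before p (q l) (q k))"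
    unfolding before_def using enumerate_wrt[OF r] by blast
  then obtain q where q: "\<And>p. bij_betw (q p) {..<n} {..<n}"
    and qb: "\<And>p k l. k < n \<Longrightarrow> l < k \<Longrightarrow> before p (q p l) (q p k)"
    by metis
  have asym: "\<not> before p j i" if "before p i j" for p i j using that unfolding before_def by linarith
  have qn: "q p k < n" if "k < n" for p k using q[of p] that by (auto simp: bij_betw_def)
  have index: "\<exists>l<n. q p l = j" if "j < n" for p j
    using q[of p] that unfolding bij_betw_def by (metis imageE lessThan_iff)
  have pos: "\<exists>l<k. q p l = i" if "i < n" "k < n" "before p i (q p k)" for p i k
  proof -
    obtain l where l: "l < n" "q p l = i" using index \<open>i < n\<close> by blast
    have "\<not> k < l" using qb[of l k p] l that asym by blast
    moreover have "l \<noteq> k" using that l asym by blast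
    ultimately show ?thesis using l by (metis nat_neq_iff)
  qed
  have pred: "before p i j" if "p \<in> realizations n" "i < n" "j < n" "r i < r j" "a i = a j" for p i j
  proof -
    have "0 \<le> p i" using that by (auto simp: realizations_def PiE_iff)
    then show ?thesis using fixed_completion_le[OF r that(1-3) that(5,4)] that unfolding before_def by linarith
  qed
  have decide: "q p' k = q p k \<and> start (?F p') (q p k) = start (?F p) (q p k)"
    if p: "p \<in> realizations n" and p': "p' \<in> realizations n" and k: "k < n"
      and eq: "\<And>l. l < k \<Longrightarrow> q p' l = q p l \<and>
             same_observation (start (?F p) (q p k)) (?F p) p (?F p') p' (q p l)" for p p' k
  proof -
    define t j j' where "t = start (?F p) (q p k)" "j = q p k" "j' = q p' k"
    note [simp del] = fixed_assignment_policy_simps(1)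
    have jn: "j < n" "j' < n" unfolding t_j_j'_def using qn k by auto
    have 1: "start (?F p') j = start (?F p) j"
    proof -
      have "p' i = p i" if i: "i < n" "r i < r j" "a i = a j" for i
      proof -
        obtain l where l: "l < k" "q p l = i"
          using pos[OF i(1) k pred[OF p i(1) qn[OF k]]] i unfolding t_j_j'_def by blast
        have "start (?F p) i + p i \<le> t"
          using fixed_completion_le[OF r p that(1) jn(1) that(3,2)] by (simp add: t_j_j'_def)
        then show ?thesis using eq[OF l(1)] l unfolding same_observation_def t_j_j'_def by auto
      qed
      then show ?thesis unfolding fixed_assignment_policy_simps by (intro sum.cong) auto
    qed
    have "j' = j"
    proof (rule ccontr)
      assume ne: "j' \<noteq> j"
      obtain l where l: "l < n" "q p' l = j" using index jn by blast
      have nl: "\<not> l < k" using eq[of l] l q[of p] k unfolding t_j_j'_def bij_betw_def inj_on_def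
        by (metis lessThan_iff nat_neq_iff)
      have "l \<noteq> k" using l ne unfolding t_j_j'_def by auto
      with nl have b': "before p' j' j" using qb[of l k p'] l unfolding t_j_j'_def by auto
      then have st: "start (?F p') j' \<le> t" using 1 unfolding before_def t_j_j'_def by auto
      have "p' i = p i" if i: "i < n" "r i < r j'" "a i = a j'" for i
      proof -
        obtain l where l: "l < k" "q p' l = i"
          using pos[OF i(1) k pred[OF p' i(1) qn[OF k]]] i unfolding t_j_j'_def by blast
        have "start (?F p') i + p' i \<le> t"
          using fixed_completion_le[OF r p' that(1) jn(2) that(3,2)] st by simp
        then show ?thesis using eq[OF l(1)] l unfolding same_observation_def t_j_j'_def
          by (auto split: if_splits)
      qed
      then have "start (?F p') j' = start (?F p) j'"
        unfolding fixed_assignment_policy_simps by (intro sum.cong) auto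
      with b' 1 have "before p j' j" unfolding before_def by simp
      then obtain l' where l': "l' < k" "q p l' = j'" using pos[OF jn(2) k] unfolding t_j_j'_def by blast
      then have "q p' l' = q p' k" using eq[of l'] unfolding t_j_j'_def by simp
      then show False using q[of p'] k l' unfolding bij_betw_def inj_on_def
        by (metis lessThan_iff nat_neq_iff order.strict_trans)
    qed
    with 1 show ?thesis unfolding t_j_j'_def by simp
  qed
  have le: "start (?F p) (q p l) \<le> start (?F p) (q p k)" if "l < k" "k < n" for p k l
    using qb[OF that(2,1), of p] unfolding before_def by linarith
  have "non_anticipatory n ?F"
    unfolding non_anticipatory_def
  proof (intro exI[of _ q] conjI ballI allI impI)
    fix p p' k
    assume *: "p \<in> realizations n" "p' \<in> realizations n" "k < n"
      "\<forall>l<k. q p' l = q p l \<and>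
             same_observation (start (?F p) (q p k)) (?F p) p (?F p') p' (q p l)"
    show "q p' k = q p k" using decide[OF *(1-3)] *(4) by blast
    show "start (?F p') (q p k) = start (?F p) (q p k)" using decide[OF *(1-3)] *(4) by blast
    show "machine (?F p') (q p k) = machine (?F p) (q p k)"
      by (simp only: fixed_assignment_policy_simps(2))
  qed (use q le in blast)+
  with feas meas show ?thesis unfolding policies_def by (simp del: fixed_assignment_policy_simps(1))
qed

lemma workload_fixed_assignment_policy:
  assumes r: "inj_on r {..<n}" and p: "p \<in> realizations n"
  shows "workload n p (fixed_assignment_policy n r a p) i = (\<Sum>j | j < n \<and> a j = i. p j)"
    (is "_ = ?L")
proof -
  let ?F = "fixed_assignment_policy n r a p"
  let ?J = "{j. j < n \<and> a j = i}" and ?C = "{start ?F j + p j | j. j < n \<and> machine ?F j = i}"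
  have C: "?C = (\<lambda>j. \<Sum>l | l < n \<and> r l \<le> r j \<and> a l = i. p l) ` ?J"
    unfolding setcompr_eq_image using fixed_completion[OF r, of _ a p]
    by (intro image_cong) (auto simp del: fixed_assignment_policy_simps(1))
  have nn: "0 \<le> p j" if "j < n" for j using p that by (auto simp: realizations_def PiE_iff)
  show ?thesis unfolding workload_def
  proof (rule Max_eqI)
    show "finite (insert 0 ?C)" unfolding C by simp
    show "y \<le> ?L" if "y \<in> insert 0 ?C" for y
      using that nn unfolding C by (auto intro!: sum_nonneg sum_mono2)
    show "?L \<in> insert 0 ?C"
    proof (cases "?J = {}")
      case False
      have "Max (r ` ?J) \<in> r ` ?J" using False by (intro Max_in) auto
      then obtain j where j: "j \<in> ?J" "Max (r ` ?J) = r j" by (elim imageE)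
      have "{l. l < n \<and> r l \<le> r j \<and> a l = i} = ?J"
        using Max_ge[of "r ` ?J"] unfolding j(2) by auto
      then show ?thesis unfolding C using j(1) by (intro insertI2 image_eqI[of _ _ j]) auto
    qed (auto simp only: sum.empty)
  qed
qed

lemma cost_fixed_assignment_policy:
  assumes I: "sebp_instance M P n m" and r: "inj_on r {..<n}"
  shows "cost M P n m (fixed_assignment_policy n r a)
         = ennreal (\<Sum>i<m. \<integral>\<omega>. max (\<Sum>j | j < n \<and> a j = i. P j \<omega>) 1 \<partial>M)"
proof -
  interpret prob_space M using I by (simp add: sebp_instance_def)
  have int: "integrable M (P j)" if "j < n" for j using I that by (simp add: sebp_instance_def)
  have "AE \<omega> in M. \<forall>j\<in>{..<n}. 0 \<le> P j \<omega>"
    using I by (intro AE_finite_allI) (auto simp: sebp_instance_def)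
  then have "cost M P n m (fixed_assignment_policy n r a)
      = (\<integral>\<^sup>+\<omega>. ennreal (\<Sum>i<m. max (\<Sum>j | j < n \<and> a j = i. P j \<omega>) 1) \<partial>M)"
    unfolding cost_def Let_def
    by (intro nn_integral_cong_AE, elim eventually_mono)
       (subst workload_fixed_assignment_policy[OF r], auto simp: realizations_def intro!: sum.cong)
  also have "\<dots> = ennreal (\<integral>\<omega>. (\<Sum>i<m. max (\<Sum>j | j < n \<and> a j = i. P j \<omega>) 1) \<partial>M)"
    using int by (intro nn_integral_eq_integral Bochner_Integration.integrable_sum integrable_max)
       (auto intro!: AE_I2 sum_nonneg)
  also have "(\<integral>\<omega>. (\<Sum>i<m. max (\<Sum>j | j < n \<and> a j = i. P j \<omega>) 1) \<partial>M)
      = (\<Sum>i<m. \<integral>\<omega>. max (\<Sum>j | j < n \<and> a j = i. P j \<omega>) 1 \<partial>M)"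
    using int by (intro Bochner_Integration.integral_sum integrable_max) auto
  finally show ?thesis .
qed

end

theory Submission
  imports Defs
begin

text \<open>
  For \<open>p\<^sub>j \<in> [0,1]\<close> the Weierstrass product inequality gives
  \<open>max (\<Sum>p\<^sub>j) 1 \<le> \<Sum>p\<^sub>j + \<Prod>(1 - p\<^sub>j)\<close>, so by independence a machine with expected load \<open>x\<^sub>i\<close> costs
  at most \<open>x\<^sub>i + \<pi>\<^sub>i\<close>, where \<open>\<pi>\<^sub>i\<close> is the product of \<open>1 - \<mu>\<^sub>j\<close> over its jobs. Let \<open>L\<close> be the smallest
  load and \<open>b\<close> the mean of the last job put on machine \<open>i\<close>. The greedy rule gives
  \<open>y = x\<^sub>i - b \<le> L\<close>, and \<open>\<pi>\<^sub>i \<le> exp (-y) (1 - b) \<le> exp (-L) (1 - (x\<^sub>i - L))\<close>. The right-hand side is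
  affine in \<open>x\<^sub>i\<close> and tangent to \<open>exp (-x)\<close> at \<open>L\<close>, so summation yields
  \<open>\<Sum>\<pi>\<^sub>i \<le> m exp (-\<rho>)\<close>. Finally \<open>\<rho> + exp (-\<rho>) \<le> (1 + exp (-1)) max \<rho> 1\<close>, and
  \<open>m max \<rho> 1\<close> is a lower bound on the cost of every policy.
\<close>

lemma max_sum_one_le:
  fixes f :: "'b \<Rightarrow> real"
  assumes "finite A" "\<And>x. x \<in> A \<Longrightarrow> 0 \<le> f x \<and> f x \<le> 1"
  shows "max (\<Sum>x\<in>A. f x) 1 \<le> (\<Sum>x\<in>A. f x) + (\<Prod>x\<in>A. 1 - f x)"
  using Weierstrass_prod_ineq[of A f] prod_nonneg[of A "\<lambda>x. 1 - f x"] assms by auto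

lemma prod_one_minus_le_exp:
  fixes f :: "'b \<Rightarrow> real"
  assumes "finite A" "\<And>x. x \<in> A \<Longrightarrow> f x \<le> 1"
  shows "(\<Prod>x\<in>A. 1 - f x) \<le> exp (- (\<Sum>x\<in>A. f x))"
proof -
  have "(\<Prod>x\<in>A. 1 - f x) \<le> (\<Prod>x\<in>A. exp (- f x))"
    using assms exp_ge_add_one_self[of "- f _"] by (intro prod_mono) auto
  also have "\<dots> = exp (- (\<Sum>x\<in>A. f x))" by (simp add: exp_sum[OF assms(1)] sum_negf[symmetric])
  finally show ?thesis .
qed

lemma exp_shift_le_tangent:
  fixes y L b :: real
  assumes "y \<le> L" "L \<le> y + b"
  shows "exp (- y) * (1 - b) \<le> exp (- L) * (1 - (y + b - L))"
proof -
  define u \<delta> where "u = L - y" and "\<delta> = y + b - L"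
  have nn: "0 \<le> u" "0 \<le> \<delta>" using assms by (auto simp: u_def \<delta>_def)
  have "exp u * (1 - u) \<le> exp u * exp (- u)"
    using exp_ge_add_one_self[of "- u"] by (intro mult_left_mono) auto
  then have "exp u * (1 - u) \<le> 1" by (simp flip: exp_add)
  moreover have "\<delta> \<le> exp u * \<delta>" using nn mult_right_mono[of 1 "exp u" \<delta>] by simp
  ultimately have "exp u * (1 - u - \<delta>) \<le> 1 - \<delta>" by (simp add: algebra_simps)
  then have "exp (- L) * (exp u * (1 - u - \<delta>)) \<le> exp (- L) * (1 - \<delta>)" by simp
  moreover have "exp (- L) * exp u = exp (- y)" by (simp add: u_def flip: exp_add)
  moreover have "1 - u - \<delta> = 1 - b" by (simp add: u_def \<delta>_def)
  ultimately show ?thesis unfolding \<delta>_def by (metis mult.assoc)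
qed

lemma greedy_sum_prod_le:
  fixes \<mu> :: "nat \<Rightarrow> real" and r :: "nat \<Rightarrow> nat" and a :: "nat \<Rightarrow> nat"
  assumes m: "1 \<le> m" and r: "inj_on r {..<n}"
    and \<mu>: "\<And>j. j < n \<Longrightarrow> 0 \<le> \<mu> j \<and> \<mu> j \<le> 1"
    and a: "\<And>j. j < n \<Longrightarrow> a j < m"
    and greedy: "\<And>j i. j < n \<Longrightarrow> i < m \<Longrightarrow>
      (\<Sum>l | l < n \<and> r l < r j \<and> a l = a j. \<mu> l) \<le> (\<Sum>l | l < n \<and> r l < r j \<and> a l = i. \<mu> l)"
  shows "(\<Sum>i<m. \<Prod>j | j < n \<and> a j = i. 1 - \<mu> j) \<le> real m * exp (- ((\<Sum>j<n. \<mu> j) / real m))"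
proof -
  define J where "J i = {j. j < n \<and> a j = i}" for i
  define x where "x i = (\<Sum>j\<in>J i. \<mu> j)" for i
  define L where "L = Min (x ` {..<m})"
  have fin: "finite (J i)" for i by (simp add: J_def)
  have L_le: "L \<le> x i" if "i < m" for i using that by (simp add: L_def)
  have "L \<in> x ` {..<m}" unfolding L_def using m by (intro Min_in) (auto simp: lessThan_empty_iff)
  then obtain i0 where i0: "i0 < m" "L = x i0" by auto
  have tangent: "(\<Prod>j\<in>J i. 1 - \<mu> j) \<le> exp (- L) * (1 - (x i - L))" if i: "i < m" for i
  proof (cases "J i = {}")
    case True
    have "0 \<le> x i0" unfolding x_def J_def using \<mu> by (intro sum_nonneg) auto
    then have "L = 0" using L_le[OF i] True i0 by (simp add: x_def)
    then show ?thesis using True by (simp add: x_def)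
  next
    case False
    have "Max (r ` J i) \<in> r ` J i" using False fin by (intro Max_in) auto
    then obtain j where j: "j \<in> J i" "Max (r ` J i) = r j" by (elim imageE)
    define K where "K = {l. l < n \<and> r l < r j \<and> a l = i}"
    have "r l < r j" if "l \<in> J i" "l \<noteq> j" for l
      using Max_ge[of "r ` J i" "r l"] fin that j(1) r unfolding j(2)
      by (auto simp: J_def inj_on_def le_less)
    then have JK: "J i = insert j K" using j(1) by (auto simp: J_def K_def)
    have K: "finite K" "j \<notin> K" by (auto simp: K_def)
    have jn: "j < n" "a j = i" using j(1) by (auto simp: J_def)
    define y where "y = (\<Sum>l\<in>K. \<mu> l)"
    have xi: "x i = y + \<mu> j" using K by (simp add: x_def JK y_def)
    have "y \<le> (\<Sum>l | l < n \<and> r l < r j \<and> a l = i0. \<mu> l)"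
      using greedy[OF jn(1) i0(1)] jn by (simp add: y_def K_def)
    also have "\<dots> \<le> L" unfolding i0(2) x_def J_def using \<mu> by (intro sum_mono2) auto
    finally have y: "y \<le> L" .
    have "(\<Prod>l\<in>K. 1 - \<mu> l) \<le> exp (- y)"
      unfolding y_def using K \<mu> by (intro prod_one_minus_le_exp) (auto simp: K_def)
    then have "(1 - \<mu> j) * (\<Prod>l\<in>K. 1 - \<mu> l) \<le> (1 - \<mu> j) * exp (- y)"
      using \<mu>[OF jn(1)] by (intro mult_left_mono) auto
    also have "\<dots> \<le> exp (- L) * (1 - (x i - L))"
      using exp_shift_le_tangent[OF y, of "\<mu> j"] L_le[OF i] by (simp add: xi mult.commute)
    finally show ?thesis using K by (simp add: JK)
  qed
  define \<rho> where "\<rho> = (\<Sum>j<n. \<mu> j) / real m"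
  have "(\<Sum>i<m. x i) = (\<Sum>j<n. \<mu> j)"
    using sum.group[of "{..<n}" "{..<m}" a \<mu>] a by (auto simp: x_def J_def)
  then have sum_x: "(\<Sum>i<m. x i) = real m * \<rho>" using m by (simp add: \<rho>_def)
  have "(\<Sum>i<m. \<Prod>j\<in>J i. 1 - \<mu> j) \<le> (\<Sum>i<m. exp (- L) * (1 - (x i - L)))"
    using tangent by (intro sum_mono) auto
  also have "\<dots> = exp (- L) * (real m * (1 + (L - \<rho>)))"
    by (simp add: sum_x sum_subtractf right_diff_distrib distrib_left flip: sum_distrib_left)
  also have "\<dots> \<le> exp (- L) * (real m * exp (L - \<rho>))"
    using exp_ge_add_one_self[of "L - \<rho>"] by (intro mult_left_mono) auto
  also have "\<dots> = real m * exp (- \<rho>)" by (simp add: exp_diff exp_minus field_simps)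
  finally show ?thesis by (simp add: J_def \<rho>_def)
qed

lemma add_exp_minus_le:
  fixes x :: real
  assumes "0 \<le> x"
  shows "x + exp (- x) \<le> (1 + exp (-1)) * max x 1"
proof (cases "1 \<le> x")
  case True
  have "exp (- x) \<le> exp (-1)" using True by simp
  also have "\<dots> \<le> exp (-1) * x" using True by simp
  finally show ?thesis using True by (simp add: algebra_simps)
next
  case False
  have "exp (- x) * x \<le> exp (- x) * exp (x - 1)"
    using exp_ge_add_one_self[of "x - 1"] by (intro mult_left_mono) auto
  also have "\<dots> = exp (-1)" by (simp flip: exp_add)
  finally have "exp (- x) - exp (-1) \<le> exp (- x) * (1 - x)" by (simp add: algebra_simps)
  also have "\<dots> \<le> 1 - x" using assms False by (intro mult_left_le_one_le) auto
  finally show ?thesis using False by simp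
qed

lemma (in prob_space) expectation_max_sum_one_le:
  fixes X :: "'b \<Rightarrow> 'a \<Rightarrow> real"
  assumes fin: "finite A" and ind: "indep_vars (\<lambda>_. borel) X A"
    and int: "\<And>j. j \<in> A \<Longrightarrow> integrable M (X j)"
    and short: "\<And>j. j \<in> A \<Longrightarrow> AE \<omega> in M. 0 \<le> X j \<omega> \<and> X j \<omega> \<le> 1"
  shows "expectation (\<lambda>\<omega>. max (\<Sum>j\<in>A. X j \<omega>) 1)
    \<le> (\<Sum>j\<in>A. expectation (X j)) + (\<Prod>j\<in>A. 1 - expectation (X j))"
proof -
  have ind': "indep_vars (\<lambda>_. borel) (\<lambda>j \<omega>. 1 - X j \<omega>) A"
    using ind by (rule indep_vars_compose2[where Y = "\<lambda>_ x. 1 - x"]) simp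
  have int': "integrable M (\<lambda>\<omega>. 1 - X j \<omega>)" if "j \<in> A" for j using int[OF that] by simp
  have intp: "integrable M (\<lambda>\<omega>. \<Prod>j\<in>A. 1 - X j \<omega>)"
    using fin ind' int' by (rule indep_vars_integrable)
  have "AE \<omega> in M. \<forall>j\<in>A. 0 \<le> X j \<omega> \<and> X j \<omega> \<le> 1"
    using fin short by (intro AE_finite_allI) auto
  then have "AE \<omega> in M. max (\<Sum>j\<in>A. X j \<omega>) 1 \<le> (\<Sum>j\<in>A. X j \<omega>) + (\<Prod>j\<in>A. 1 - X j \<omega>)"
    by eventually_elim (rule max_sum_one_le[OF fin], blast)
  then have "expectation (\<lambda>\<omega>. max (\<Sum>j\<in>A. X j \<omega>) 1)
      \<le> expectation (\<lambda>\<omega>. (\<Sum>j\<in>A. X j \<omega>) + (\<Prod>j\<in>A. 1 - X j \<omega>))"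
    using int intp by (intro integral_mono_AE integrable_max Bochner_Integration.integrable_add
        Bochner_Integration.integrable_sum) auto
  also have "\<dots> = (\<Sum>j\<in>A. expectation (X j)) + expectation (\<lambda>\<omega>. \<Prod>j\<in>A. 1 - X j \<omega>)"
    using int intp by (simp add: Bochner_Integration.integral_add Bochner_Integration.integral_sum)
  also have "expectation (\<lambda>\<omega>. \<Prod>j\<in>A. 1 - X j \<omega>) = (\<Prod>j\<in>A. expectation (\<lambda>\<omega>. 1 - X j \<omega>))"
    using fin ind' int' by (rule indep_vars_lebesgue_integral)
  also have "\<dots> = (\<Prod>j\<in>A. 1 - expectation (X j))"
    using int by (intro prod.cong) (auto simp: prob_space)
  finally show ?thesis .
qed

lemma sum_durations_le_horizon:
  fixes s p :: "'b \<Rightarrow> real"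
  assumes "finite J" "0 \<le> W"
    and "\<And>j. j \<in> J \<Longrightarrow> 0 \<le> s j \<and> 0 \<le> p j \<and> s j + p j \<le> W"
    and "\<And>j k. j \<in> J \<Longrightarrow> k \<in> J \<Longrightarrow> j \<noteq> k \<Longrightarrow> s j + p j \<le> s k \<or> s k + p k \<le> s j"
  shows "(\<Sum>j\<in>J. p j) \<le> W"
  using assms
proof (induction J arbitrary: W rule: finite_ranking_induct[where f = s])
  case (insert j J)
  show ?case
  proof (cases "p j = 0")
    case True
    have "(\<Sum>j\<in>J. p j) \<le> W" using insert.prems by (intro insert.IH) auto
    then show ?thesis using True insert.hyps by (simp add: sum.insert_if)
  next
    case False
    then have pj: "0 < p j" using insert.prems(2)[of j] by auto
    have notin: "j \<notin> J \<or> ?thesis"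
      using insert.IH[OF insert.prems(1)] insert.prems by (auto simp: insert_absorb)
    have "(\<Sum>j\<in>J. p j) \<le> s j" if "j \<notin> J"
    proof (rule insert.IH)
      fix k assume k: "k \<in> J"
      then have "s k + p k \<le> s j \<or> s j + p j \<le> s k"
        using insert.prems(3)[of j k] that by auto
      then show "0 \<le> s k \<and> 0 \<le> p k \<and> s k + p k \<le> s j"
        using insert.hyps(2)[OF k] pj insert.prems(2)[of k] k by auto
    qed (use insert.prems in auto)
    then show ?thesis using notin insert.prems(2)[of j] insert.hyps(1) by fastforce
  qed
qed simp

lemma sum_durations_le_workload:
  assumes feas: "feasible n m p s" and p: "p \<in> realizations n"
  shows "(\<Sum>j | j < n \<and> machine s j = i. p j) \<le> workload n p s i"
proof -
  have fin: "finite (insert 0 {start s j + p j | j. j < n \<and> machine s j = i})" by simp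
  note ge = Max_ge[OF fin, folded workload_def]
  show ?thesis
  proof (rule sum_durations_le_horizon[where s = "start s"])
    show "0 \<le> workload n p s i" by (rule ge) simp
    fix j assume "j \<in> {j. j < n \<and> machine s j = i}"
    then show "0 \<le> start s j \<and> 0 \<le> p j \<and> start s j + p j \<le> workload n p s i"
      using feas p by (auto simp: feasible_def realizations_def PiE_iff intro!: ge)
  qed (use feas in \<open>auto simp: feasible_def\<close>)
qed

lemma sum_durations_le_sum_workloads:
  assumes feas: "feasible n m p s" and p: "p \<in> realizations n"
  shows "(\<Sum>j<n. p j) \<le> (\<Sum>i<m. max (workload n p s i) 1)"
proof -
  have "(\<Sum>j<n. p j) = (\<Sum>i<m. \<Sum>j | j < n \<and> machine s j = i. p j)"
    using sum.group[of "{..<n}" "{..<m}" "machine s" p] feas by (simp add: feasible_def image_subset_iff)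
  also have "\<dots> \<le> (\<Sum>i<m. max (workload n p s i) 1)"
    using sum_durations_le_workload[OF assms] by (intro sum_mono) (auto intro: max.coboundedI1)
  finally show ?thesis .
qed

lemma policy_cost_ge:
  assumes I: "sebp_instance M P n m" and \<pi>: "\<pi> \<in> policies n m"
  shows "ennreal (max (\<Sum>j<n. integral\<^sup>L M (P j)) (real m)) \<le> cost M P n m \<pi>"
proof -
  interpret prob_space M using I by (simp add: sebp_instance_def)
  have int: "integrable M (P j)" if "j < n" for j using I that by (simp add: sebp_instance_def)
  have nonneg: "AE \<omega> in M. \<forall>j\<in>{..<n}. 0 \<le> P j \<omega>"
    using I by (intro AE_finite_allI) (auto simp: sebp_instance_def)
  have "ennreal (\<Sum>j<n. integral\<^sup>L M (P j)) = ennreal (\<integral>\<omega>. (\<Sum>j<n. P j \<omega>) \<partial>M)"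
    using int by (simp add: Bochner_Integration.integral_sum)
  also have "\<dots> = (\<integral>\<^sup>+\<omega>. ennreal (\<Sum>j<n. P j \<omega>) \<partial>M)"
    using int nonneg by (intro nn_integral_eq_integral[symmetric])
      (auto elim!: eventually_mono intro!: sum_nonneg)
  also have "\<dots> \<le> cost M P n m \<pi>"
    unfolding cost_def
  proof (rule nn_integral_mono_AE, use nonneg in eventually_elim)
    fix \<omega> assume nn: "\<forall>j\<in>{..<n}. 0 \<le> P j \<omega>"
    define p where "p = (\<lambda>j\<in>{..<n}. P j \<omega>)"
    have p: "p \<in> realizations n" using nn by (auto simp: p_def realizations_def)
    then have "(\<Sum>j<n. p j) \<le> (\<Sum>i<m. max (workload n p (\<pi> p) i) 1)"
      using \<pi> by (intro sum_durations_le_sum_workloads) (auto simp: policies_def)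
    then show "ennreal (\<Sum>j<n. P j \<omega>) \<le> (let p = (\<lambda>j\<in>{..<n}. P j \<omega>)
            in ennreal (\<Sum>i<m. max (workload n p (\<pi> p) i) 1))"
      by (simp add: p_def[symmetric]) (simp add: p_def ennreal_leI)
  qed
  finally have 1: "ennreal (\<Sum>j<n. integral\<^sup>L M (P j)) \<le> cost M P n m \<pi>" .
  have "ennreal (real m) = (\<integral>\<^sup>+\<omega>. ennreal (real m) \<partial>M)" by (simp add: emeasure_space_1)
  also have "\<dots> \<le> cost M P n m \<pi>"
    unfolding cost_def Let_def
  proof (intro nn_integral_mono ennreal_leI)
    fix \<omega>
    let ?p = "\<lambda>j\<in>{..<n}. P j \<omega>"
    have "real m = (\<Sum>i<m. 1)" by simp
    also have "\<dots> \<le> (\<Sum>i<m. max (workload n ?p (\<pi> ?p) i) 1)" by (intro sum_mono) simp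
    finally show "real m \<le> (\<Sum>i<m. max (workload n ?p (\<pi> ?p) i) 1)" .
  qed
  finally show ?thesis using 1 by (simp add: max_def)
qed

theorem theorem2:
  fixes M :: "'a measure" and P :: "nat \<Rightarrow> 'a \<Rightarrow> real" and n m :: nat
    and \<rho> :: real and r a :: "nat \<Rightarrow> nat"
  assumes "sebp_instance M P n m"
    and short: "\<forall>j<n. measure M {\<omega> \<in> space M. 0 \<le> P j \<omega> \<and> P j \<omega> \<le> 1} = 1"
    and \<rho>: "\<rho> = (\<Sum>j<n. integral\<^sup>L M (P j)) / real m"
    and lept: "lept_assignment M P n m r a"
  shows "cost M P n m (fixed_assignment_policy n r a) / ennreal (real m * max \<rho> 1)
           \<le> ennreal (1 + exp (-1))
       \<and> cost M P n m (fixed_assignment_policy n r a)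
           \<le> ennreal (1 + exp (-1)) * opt_cost M P n m"
proof -
  let ?\<mu> = "\<lambda>j. integral\<^sup>L M (P j)"
  let ?C = "cost M P n m (fixed_assignment_policy n r a)"
  note I = assms(1)
  interpret prob_space M using I by (simp add: sebp_instance_def)
  have m: "1 \<le> m" and ind: "indep_vars (\<lambda>_. borel) P {..<n}"
    and int: "\<And>j. j < n \<Longrightarrow> integrable M (P j)"
    using I by (auto simp: sebp_instance_def)
  have unit: "AE \<omega> in M. 0 \<le> P j \<omega> \<and> P j \<omega> \<le> 1" if "j < n" for j
    using AE_prob_1[OF short[rule_format, OF that]] by eventually_elim simp
  have \<mu>: "0 \<le> ?\<mu> j \<and> ?\<mu> j \<le> 1" if "j < n" for j
  proof
    show "0 \<le> ?\<mu> j" using unit[OF that] by (intro integral_nonneg_AE) (auto elim: eventually_mono)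
    have "?\<mu> j \<le> (\<integral>\<omega>. 1 \<partial>M)"
      using unit[OF that] int[OF that] by (intro integral_mono_AE) (auto elim: eventually_mono)
    then show "?\<mu> j \<le> 1" by (simp add: prob_space)
  qed
  have r: "inj_on r {..<n}" and a: "\<And>j. j < n \<Longrightarrow> a j < m"
    using lept by (auto simp: lept_assignment_def bij_betw_def)
  have sum_\<mu>: "(\<Sum>j<n. ?\<mu> j) = real m * \<rho>" using m \<rho> by simp
  have \<rho>_nonneg: "0 \<le> \<rho>" unfolding \<rho> using \<mu> by (intro divide_nonneg_nonneg sum_nonneg) auto
  have "(\<Sum>i<m. \<integral>\<omega>. max (\<Sum>j | j < n \<and> a j = i. P j \<omega>) 1 \<partial>M)
      \<le> (\<Sum>i<m. (\<Sum>j | j < n \<and> a j = i. ?\<mu> j) + (\<Prod>j | j < n \<and> a j = i. 1 - ?\<mu> j))"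
    using int unit by (intro sum_mono expectation_max_sum_one_le)
      (auto intro: indep_vars_subset[OF ind])
  also have "\<dots> = real m * \<rho> + (\<Sum>i<m. \<Prod>j | j < n \<and> a j = i. 1 - ?\<mu> j)"
    using sum.group[of "{..<n}" "{..<m}" a ?\<mu>] a by (auto simp: sum.distrib sum_\<mu>)
  also have "\<dots> \<le> real m * \<rho> + real m * exp (- \<rho>)"
    unfolding \<rho> using m r \<mu> a lept
    by (intro add_left_mono greedy_sum_prod_le) (auto simp: lept_assignment_def)
  also have "\<dots> \<le> (1 + exp (-1)) * (real m * max \<rho> 1)"
    using mult_left_mono[OF add_exp_minus_le[OF \<rho>_nonneg], of "real m"] by (simp add: algebra_simps)
  finally have "ennreal (\<Sum>i<m. \<integral>\<omega>. max (\<Sum>j | j < n \<and> a j = i. P j \<omega>) 1 \<partial>M)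
      \<le> ennreal ((1 + exp (-1)) * (real m * max \<rho> 1))" by (rule ennreal_leI)
  then have C: "?C \<le> ennreal (1 + exp (-1)) * ennreal (real m * max \<rho> 1)"
    unfolding cost_fixed_assignment_policy[OF I r] by (subst ennreal_mult[symmetric]) auto
  have "ennreal (real m * max \<rho> 1) \<le> opt_cost M P n m"
    unfolding opt_cost_def
  proof (rule INF_greatest)
    fix \<pi> assume "\<pi> \<in> policies n m"
    then show "ennreal (real m * max \<rho> 1) \<le> cost M P n m \<pi>"
      using policy_cost_ge[OF I] by (simp add: sum_\<mu> max_mult_distrib_left)
  qed
  then have "?C \<le> ennreal (1 + exp (-1)) * opt_cost M P n m"
    using C by (meson mult_left_mono order_trans zero_le)
  moreover have "?C / ennreal (real m * max \<rho> 1) \<le> ennreal (1 + exp (-1))"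
    using C m by (intro divide_le_posI_ennreal) (auto simp: mult.commute)
  ultimately show ?thesis by blast
qed

end
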